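(* There is no function $F:\mathbb F_2^4\to\mathbb F_2$ such that, for every pair of primes $p\ne q$ with $p\equiv q\equiv1\pmod8$ and $\left(\frac qp\right)=1$, $$\Pi(p,q)=F\!\left(c_p,c_q,\left[\frac pq\right]_4,\left[\frac qp\right]_4\right).$$ The same assertion holds with $\Pi_2(p,q)$ in place of $\Pi(p,q)$.
   Context: For odd positive $m$ and $(A,m)=1$, $\left[\frac Am\right]\in\mathbb F_2$ is defined by $(-1)^{[A/m]}=\left(\frac Am\right)$ (Jacobi symbol). For a prime $\ell\equiv1\pmod4$ and $(a/\ell)=1$, $\left[\frac a\ell\right]_4\in\mathbb F_2$ is defined by $(-1)^{[a/\ell]_4}\equiv a^{(\ell-1)/4}\pmod\ell$. For a prime $\ell\equiv1\pmod8$, $c_\ell=\left[\frac{r_\ell+1}{\ell}\right]$ where $r_\ell^2\equiv2\pmod\ell$ (independent of the root). Let $p\ne q$ be primes, $p\equiv q\equiv1\pmod8$, $(q/p)=1$. A primitive positive solution means positive integers with greatest common divisor $1$; all solutions below exist. Choose primitive positive solutions of $p\alpha^2+q\beta^2=4\gamma^2$, $p\alpha'^2-q\beta'^2=4\gamma'^2$, $p\alpha''^2-2q\beta''^2=4\gamma''^2$, set $u=\left[\frac{\gamma}{q}\right]$, $v=\left[\frac{\gamma}{p}\right]$, $\delta=\left[\frac{\gamma'\gamma''}{q}\right]$, and $$\Pi(p,q)=c_pc_q+c_pu+c_qv+\delta(u+v)\in\mathbb F_2.$$ Choose primitive positive solutions of $p\alpha_p^2+2q\beta_p^2=4\gamma_p^2$,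 $q\alpha_q^2+2p\beta_q^2=4\gamma_q^2$, $p\alpha_p'^2-2q\beta_p'^2=4\gamma_p'^2$, $q\alpha_q'^2-2p\beta_q'^2=4\gamma_q'^2$, $p\alpha_p''^2-4q\beta_p''^2=4\gamma_p''^2$, set $u_{\mathrm e}=\left[\frac{\gamma_p}{q}\right]$, $v_{\mathrm e}=\left[\frac{\gamma_p'}{q}\right]$, $\delta_{\mathrm e}=\left[\frac{\gamma_p'\gamma_p''}{q}\right]$, $w_p=c_p+\left[\frac{\gamma_p'}{p}\right]$, $w_q=c_q+\left[\frac{\gamma_q'}{q}\right]$, and $$\Pi_2(p,q)=\delta_{\mathrm e}(u_{\mathrm e}+v_{\mathrm e})+w_pw_q+u_{\mathrm e}v_{\mathrm e}\in\mathbb F_2.$$ Both values are independent of the chosen solutions. *)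

theory Defs
  imports "HOL-Number_Theory.Number_Theory" "HOL-Library.Z2"
begin

definition Jacobi :: "int \<Rightarrow> nat \<Rightarrow> int" where
  "Jacobi A m = (\<Prod>l\<in>#prime_factorization m. Legendre A (int l))"

text \<open>The field with two elements is the type \<open>bit\<close>; \<open>neg_one_pow b\<close> is $(-1)^b$.\<close>

definition neg_one_pow :: "bit \<Rightarrow> int" where
  "neg_one_pow b = (if b = 0 then 1 else - 1)"

text \<open>The additive symbol $[A/m]$, meaningful for odd positive \<open>m\<close> coprime to \<open>A\<close>.\<close>

definition add_symbol :: "int \<Rightarrow> nat \<Rightarrow> bit" where
  "add_symbol A m = (THE b. neg_one_pow b = Jacobi A m)"

text \<open>The additive quartic symbol $[a/l]_4$, meaningful for a prime $l \equiv 1 \pmod 4$ and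
  a nonzero quadratic residue \<open>a\<close> modulo \<open>l\<close>.\<close>

definition add_symbol4 :: "int \<Rightarrow> nat \<Rightarrow> bit" where
  "add_symbol4 a l = (THE b. [neg_one_pow b = a ^ ((l - 1) div 4)] (mod int l))"

text \<open>Meaningful for a prime $l \equiv 1 \pmod 8$; the value does not depend on the root chosen.\<close>

definition c_symbol :: "nat \<Rightarrow> bit" where
  "c_symbol l = add_symbol ((SOME r. [r\<^sup>2 = 2] (mod int l)) + 1) l"

text \<open>Primitive positive solutions of $a\alpha^2 + b\beta^2 = 4\gamma^2$; the coefficient \<open>b\<close> may
  be negative.\<close>

definition primitive_solution :: "int \<Rightarrow> int \<Rightarrow> int \<Rightarrow> int \<Rightarrow> int \<Rightarrow> bool" where
  "primitive_solution a b \<alpha> \<beta> \<gamma> \<longleftrightarrow>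
     0 < \<alpha> \<and> 0 < \<beta> \<and> 0 < \<gamma> \<and> gcd (gcd \<alpha> \<beta>) \<gamma> = 1 \<and> a * \<alpha>\<^sup>2 + b * \<beta>\<^sup>2 = 4 * \<gamma>\<^sup>2"

text \<open>The component $\gamma$ of an arbitrarily chosen primitive positive solution; only this
  component enters the invariants below.\<close>

definition solution_gamma :: "int \<Rightarrow> int \<Rightarrow> int" where
  "solution_gamma a b = (SOME \<gamma>. \<exists>\<alpha> \<beta>. primitive_solution a b \<alpha> \<beta> \<gamma>)"

definition Pi_inv :: "nat \<Rightarrow> nat \<Rightarrow> bit" where
  "Pi_inv p q =
     (let \<gamma> = solution_gamma (int p) (int q);
          \<gamma>' = solution_gamma (int p) (- int q);
          \<gamma>'' = solution_gamma (int p) (- (2 * int q));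
          u = add_symbol \<gamma> q;
          v = add_symbol \<gamma> p;
          \<delta> = add_symbol (\<gamma>' * \<gamma>'') q
      in c_symbol p * c_symbol q + c_symbol p * u + c_symbol q * v + \<delta> * (u + v))"

definition Pi2_inv :: "nat \<Rightarrow> nat \<Rightarrow> bit" where
  "Pi2_inv p q =
     (let \<gamma>\<^sub>p = solution_gamma (int p) (2 * int q);
          \<gamma>\<^sub>p' = solution_gamma (int p) (- (2 * int q));
          \<gamma>\<^sub>q' = solution_gamma (int q) (- (2 * int p));
          \<gamma>\<^sub>p'' = solution_gamma (int p) (- (4 * int q));
          u = add_symbol \<gamma>\<^sub>p q;
          v = add_symbol \<gamma>\<^sub>p' q;
          \<delta> = add_symbol (\<gamma>\<^sub>p' * \<gamma>\<^sub>p'') q;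
          w\<^sub>p = c_symbol p + add_symbol \<gamma>\<^sub>p' p;
          w\<^sub>q = c_symbol q + add_symbol \<gamma>\<^sub>q' q
      in \<delta> * (u + v) + w\<^sub>p * w\<^sub>q + u * v)"

definition admissible_pair :: "nat \<Rightarrow> nat \<Rightarrow> bool" where
  "admissible_pair p q \<longleftrightarrow>
     prime p \<and> prime q \<and> p \<noteq> q \<and> [p = 1] (mod 8) \<and> [q = 1] (mod 8) \<and> Jacobi (int q) p = 1"

end

theory Submission
  imports Defs
begin

text \<open>
  The proof is a counterexample: the pairs \<open>(p, q) = (17, 89)\<close> and \<open>(97, 73)\<close> have the same
  quadruple of arguments \<open>(1, 1, 1, 0)\<close>, while both \<open>Pi_inv\<close> and \<open>Pi2_inv\<close> take the value \<open>0\<close> at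
  the first pair and \<open>1\<close> at the second. Both pairs have distinct quartic symbols
  $[p/q]_4 \neq [q/p]_4$, as they must for \<open>Pi_inv\<close>: modulo \<open>q\<close> the equation
  $p\alpha^2 + q\beta^2 = 4\gamma^2$ makes $\gamma$ a square root of $p/4$ times $\alpha$, which leads to
  $u = [p/q]_4$ and likewise $v = [q/p]_4$, so when these agree the term
  $\delta(u + v)$, the only one that the four arguments do not control, is absent.

  The invariants refer to arbitrarily chosen solutions of conics, so the mathematical content is
  that the symbol $[\gamma/l]$ does not depend on the choice. Let \<open>l\<close> divide the coefficient of one of
  the variables in $a\alpha^2 + b\beta^2 = 4\gamma^2$ exactly once, and let \<open>t\<close> be the value of the polar
  bilinear form at two primitive solutions,
  $t = a\alpha_0\alpha_1 + b\beta_0\beta_1 - 4\gamma_0\gamma_1$. Each of $t(t - 2a\alpha_0\alpha_1)$,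
  $t(t - 2b\beta_0\beta_1)$ and $t(t + 8\gamma_0\gamma_1)$ is a square times a divisor of $4ab$ up to sign
  (\<open>polar_form_identities\<close>). A prime \<open>r\<close> that does not divide \<open>2ab\<close> and occurs in \<open>t\<close> to an odd power
  must therefore divide all three cofactors, hence $\alpha_0\alpha_1$, $\beta_0\beta_1$ and
  $\gamma_0\gamma_1$. But \<open>r\<close> divides at most one coordinate of each primitive solution, so it cannot
  account for three products (\<open>polar_form_odd_multiplicity\<close>). Thus \<open>t\<close> is, up to sign and squares,
  a product of primes dividing \<open>2ab\<close>. All of these other than \<open>l\<close> are assumed to be squares modulo
  \<open>l\<close>, as is \<open>-1\<close>, and the third identity read modulo \<open>l\<close> then shows that
  $\gamma_0\gamma_1$ is a square (\<open>QuadRes_gamma_product\<close>). This reduces the invariants to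
  explicit small solutions (\<open>Pi_inv_eq\<close>, \<open>Pi2_inv_eq\<close>) and Euler's criterion.
\<close>

section \<open>Quadratic residues\<close>

lemma QuadRes_square: "QuadRes m (x\<^sup>2)"
  unfolding QuadRes_def by (rule exI[of _ x]) simp

lemma QuadRes_mult: "QuadRes m a \<Longrightarrow> QuadRes m b \<Longrightarrow> QuadRes m (a * b)"
  unfolding QuadRes_def by (metis cong_mult power_mult_distrib)

lemma QuadRes_cong: "[a = b] (mod m) \<Longrightarrow> QuadRes m a \<longleftrightarrow> QuadRes m b"
  unfolding QuadRes_def by (meson cong_sym cong_trans)

lemma Legendre_cong:
  assumes "[a = b] (mod m)"
  shows "Legendre a m = Legendre b m"
proof -
  have "[a = 0] (mod m) \<longleftrightarrow> [b = 0] (mod m)"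
    using assms by (meson cong_sym cong_trans)
  then show ?thesis unfolding Legendre_def QuadRes_cong[OF assms] by simp
qed

lemma QuadRes_prod: "(\<And>x. x \<in> A \<Longrightarrow> QuadRes m (f x)) \<Longrightarrow> QuadRes m (prod f A)"
proof (induction A rule: infinite_finite_induct)
  case (insert x F)
  then show ?case by (simp add: QuadRes_mult)
qed (use QuadRes_square[of m 1] in simp_all)

lemma QuadRes_cancel:
  assumes "prime l" "\<not> l dvd a" "QuadRes l a" "QuadRes l (a * b)"
  shows "QuadRes l b"
proof -
  obtain y w where y: "[y\<^sup>2 = a] (mod l)" and w: "[w\<^sup>2 = a * b] (mod l)"
    using assms(3,4) unfolding QuadRes_def by blast
  have "\<not> l dvd y"
    using cong_dvd_iff[OF y] assms(2) by (auto simp: power2_eq_square)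
  then have "coprime y l"
    using assms(1) by (simp add: coprime_commute prime_imp_coprime)
  then obtain z where z: "[y * z = 1] (mod l)"
    using cong_solve_coprime_int by blast
  have "[(w * z)\<^sup>2 = a * b * z\<^sup>2] (mod l)"
    using cong_mult[OF w cong_refl] by (simp add: power_mult_distrib)
  also have "[a * b * z\<^sup>2 = y\<^sup>2 * b * z\<^sup>2] (mod l)"
    by (intro cong_mult cong_refl cong_sym[OF y])
  also have "y\<^sup>2 * b * z\<^sup>2 = (y * z)\<^sup>2 * b"
    by (simp add: power_mult_distrib)
  also have "[(y * z)\<^sup>2 * b = 1\<^sup>2 * b] (mod l)"
    by (intro cong_mult cong_refl cong_pow z)
  finally show ?thesis
    unfolding QuadRes_def by auto
qed

text \<open>Up to sign and square factors, an integer is the product of the primes that divide it to an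
  odd power.\<close>

lemma QuadRes_of_odd_multiplicity:
  fixes t :: int
  assumes "t \<noteq> 0" "QuadRes m (- 1)"
    and "\<And>r. prime r \<Longrightarrow> odd (multiplicity r t) \<Longrightarrow> QuadRes m r"
  shows "QuadRes m t"
proof -
  have "QuadRes m (\<Prod>r\<in>prime_factors t. r ^ multiplicity r t)"
  proof (rule QuadRes_prod)
    fix r assume "r \<in> prime_factors t"
    then have "prime r" by auto
    show "QuadRes m (r ^ multiplicity r t)"
    proof (cases "even (multiplicity r t)")
      case True
      then obtain k where "multiplicity r t = 2 * k" by blast
      then show ?thesis
        using QuadRes_square[of m "r ^ k"] by (simp add: power_mult[symmetric] mult.commute)
    next
      case False
      then obtain k where "multiplicity r t = 2 * k + 1" by (blast elim: oddE)
      then show ?thesis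
        using QuadRes_mult[OF assms(3)[OF \<open>prime r\<close> False] QuadRes_square[of m "r ^ k"]]
        by (simp add: power_mult[symmetric] mult.commute)
    qed
  qed
  then have abs: "QuadRes m \<bar>t\<bar>"
    using assms(1) by (simp add: prod_prime_factors)
  show ?thesis
    using abs QuadRes_mult[OF assms(2) abs] by (cases "t \<ge> 0") auto
qed

section \<open>The class of gamma is independent of the solution\<close>

lemma even_multiplicity_cofactor:
  fixes r t s k c :: int
  assumes "prime r" "t \<noteq> 0" "\<not> r dvd s" "\<not> r dvd k" "t * s = k * c\<^sup>2"
  shows "even (multiplicity r t)"
proof -
  have r: "prime_elem r" using assms(1) by (rule prime_imp_prime_elem)
  have s: "s \<noteq> 0" and k: "k \<noteq> 0" using assms(3,4) by auto
  then have c: "c \<noteq> 0" using assms(2,5) by auto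
  have "multiplicity r t = multiplicity r (t * s)"
    using assms(2,3) s r by (simp add: prime_elem_multiplicity_mult_distrib not_dvd_imp_multiplicity_0)
  also have "\<dots> = multiplicity r (k * c\<^sup>2)"
    by (simp add: assms(5))
  also have "\<dots> = 2 * multiplicity r c"
    using assms(4) k c r
    by (simp add: prime_elem_multiplicity_mult_distrib prime_elem_multiplicity_power_distrib
        not_dvd_imp_multiplicity_0)
  finally show ?thesis by simp
qed

lemma primitive_solution_swap:
  "primitive_solution a b \<alpha> \<beta> \<gamma> \<longleftrightarrow> primitive_solution b a \<beta> \<alpha> \<gamma>"
  unfolding primitive_solution_def by (auto simp: gcd.commute algebra_simps)

lemma primitive_solution_no_common_prime:
  assumes sol: "primitive_solution a b \<alpha> \<beta> \<gamma>" and "prime r"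
  shows "r dvd \<alpha> \<Longrightarrow> r dvd \<beta> \<Longrightarrow> \<not> r dvd \<gamma>"
proof
  assume "r dvd \<alpha>" "r dvd \<beta>" "r dvd \<gamma>"
  then have "r dvd gcd (gcd \<alpha> \<beta>) \<gamma>" by simp
  then show False
    using sol \<open>prime r\<close> unfolding primitive_solution_def by auto
qed

text \<open>Modulo a prime that does not divide \<open>2ab\<close> the conic is nonsingular: if two coordinates vanish
  there, the equation forces the third to vanish too.\<close>

lemma primitive_solution_pairwise_coprime:
  assumes sol: "primitive_solution a b \<alpha> \<beta> \<gamma>" and r: "prime r" "\<not> r dvd 2 * a * b"
  shows "\<not> (r dvd \<alpha> \<and> r dvd \<beta>)" "\<not> (r dvd \<alpha> \<and> r dvd \<gamma>)" "\<not> (r dvd \<beta> \<and> r dvd \<gamma>)"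
proof -
  have eq: "a * \<alpha>\<^sup>2 + b * \<beta>\<^sup>2 = 4 * \<gamma>\<^sup>2"
    using sol unfolding primitive_solution_def by simp
  have nd: "\<not> r dvd 2" "\<not> r dvd a" "\<not> r dvd b"
    using r(2) by (meson dvd_mult dvd_mult2)+
  have r4: "r dvd 4 * x \<longleftrightarrow> r dvd x" for x
    using nd(1) r(1) by (metis mult_2 numeral_Bit0 one_add_one mult.assoc prime_dvd_mult_iff
        distrib_right)
  have *: "r dvd \<gamma>" if "r dvd \<alpha>" "r dvd \<beta>"
  proof -
    have "r dvd a * \<alpha>\<^sup>2 + b * \<beta>\<^sup>2"
      using that by (simp add: power2_eq_square)
    then show ?thesis
      using eq r4 r(1) by (simp add: prime_dvd_power_iff)
  qed
  have **: "r dvd \<beta>" if "r dvd \<alpha>" "r dvd \<gamma>"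
  proof -
    have "r dvd 4 * \<gamma>\<^sup>2 - a * \<alpha>\<^sup>2"
      using that by (simp add: power2_eq_square)
    then have "r dvd b * \<beta>\<^sup>2" using eq by (metis add_diff_cancel_left')
    then show ?thesis
      using nd(3) r(1) by (simp add: prime_dvd_mult_iff prime_dvd_power_iff)
  qed
  have ***: "r dvd \<alpha>" if "r dvd \<beta>" "r dvd \<gamma>"
  proof -
    have "r dvd 4 * \<gamma>\<^sup>2 - b * \<beta>\<^sup>2"
      using that by (simp add: power2_eq_square)
    then have "r dvd a * \<alpha>\<^sup>2" using eq by (metis add_diff_cancel_right')
    then show ?thesis
      using nd(2) r(1) by (simp add: prime_dvd_mult_iff prime_dvd_power_iff)
  qed
  show "\<not> (r dvd \<alpha> \<and> r dvd \<beta>)" "\<not> (r dvd \<alpha> \<and> r dvd \<gamma>)" "\<not> (r dvd \<beta> \<and> r dvd \<gamma>)"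
    using * ** *** primitive_solution_no_common_prime[OF sol r(1)] by blast+
qed

text \<open>In each case the product is a difference of two squares. For the first one it is
  $(by_0y_1 - 4z_0z_1)^2 - (ax_0x_1)^2$, and the equations of the two points turn $(ax_0x_1)^2$ into
  $(4z_0^2 - by_0^2)(4z_1^2 - by_1^2)$; Brahmagupta's identity then leaves a single square.\<close>

lemma polar_form_identities:
  fixes a b x0 y0 z0 x1 y1 z1 :: int
  assumes "a * x0\<^sup>2 + b * y0\<^sup>2 = 4 * z0\<^sup>2" "a * x1\<^sup>2 + b * y1\<^sup>2 = 4 * z1\<^sup>2"
  defines "t \<equiv> a * x0 * x1 + b * y0 * y1 - 4 * z0 * z1"
  shows "t * (t - 2 * a * x0 * x1) = 4 * b * (z0 * y1 - z1 * y0)\<^sup>2"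
    and "t * (t - 2 * b * y0 * y1) = 4 * a * (z0 * x1 - z1 * x0)\<^sup>2"
    and "t * (t + 8 * z0 * z1) = - a * b * (x0 * y1 - x1 * y0)\<^sup>2"
proof -
  have x: "a * x0\<^sup>2 = 4 * z0\<^sup>2 - b * y0\<^sup>2" "a * x1\<^sup>2 = 4 * z1\<^sup>2 - b * y1\<^sup>2"
    and y: "b * y0\<^sup>2 = 4 * z0\<^sup>2 - a * x0\<^sup>2" "b * y1\<^sup>2 = 4 * z1\<^sup>2 - a * x1\<^sup>2"
    using assms(1,2) by auto
  have "(a * x0\<^sup>2) * (a * x1\<^sup>2) = (4 * z0\<^sup>2 - b * y0\<^sup>2) * (4 * z1\<^sup>2 - b * y1\<^sup>2)"
    unfolding x ..
  then show "t * (t - 2 * a * x0 * x1) = 4 * b * (z0 * y1 - z1 * y0)\<^sup>2"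
    unfolding t_def by (simp add: algebra_simps power2_eq_square)
  have "(b * y0\<^sup>2) * (b * y1\<^sup>2) = (4 * z0\<^sup>2 - a * x0\<^sup>2) * (4 * z1\<^sup>2 - a * x1\<^sup>2)"
    unfolding y ..
  then show "t * (t - 2 * b * y0 * y1) = 4 * a * (z0 * x1 - z1 * x0)\<^sup>2"
    unfolding t_def by (simp add: algebra_simps power2_eq_square)
  have "(a * x0\<^sup>2 + b * y0\<^sup>2) * (a * x1\<^sup>2 + b * y1\<^sup>2) = (4 * z0\<^sup>2) * (4 * z1\<^sup>2)"
    unfolding assms(1,2) ..
  then show "t * (t + 8 * z0 * z1) = - a * b * (x0 * y1 - x1 * y0)\<^sup>2"
    unfolding t_def by (simp add: algebra_simps power2_eq_square)
qed

text \<open>This settles the degenerate case in which the polar form vanishes: the two solutions are then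
  proportional, and positive primitive vectors on one line coincide.\<close>

lemma primitive_solution_gamma_eq:
  assumes "primitive_solution a b \<alpha> \<beta> \<gamma>" "primitive_solution a b \<alpha>' \<beta>' \<gamma>'"
    and "\<gamma> * \<alpha>' = \<gamma>' * \<alpha>" "\<gamma> * \<beta>' = \<gamma>' * \<beta>"
  shows "\<gamma> = \<gamma>'"
proof -
  have scale: "k * gcd (gcd x y) z = gcd (gcd (k * x) (k * y)) (k * z)" if "0 < k" for k x y z :: int
    using that by (metis abs_of_pos gcd_mult_distrib_int)
  have pos: "0 < \<gamma>" "0 < \<gamma>'"
    and gcd1: "gcd (gcd \<alpha> \<beta>) \<gamma> = 1" "gcd (gcd \<alpha>' \<beta>') \<gamma>' = 1"
    using assms(1,2) unfolding primitive_solution_def by auto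
  have "\<gamma> * gcd (gcd \<alpha>' \<beta>') \<gamma>' = \<gamma>' * gcd (gcd \<alpha> \<beta>) \<gamma>"
    unfolding scale[OF pos(1)] scale[OF pos(2)] assms(3,4) by (simp add: mult.commute)
  then show ?thesis
    unfolding gcd1 by simp
qed

text \<open>If \<open>r\<close> did not divide \<open>2ab\<close>, each of the three identities would put \<open>r\<close> into a product of two
  like coordinates. By the pigeonhole principle one of the two solutions would have two coordinates
  divisible by \<open>r\<close>.\<close>

lemma polar_form_odd_multiplicity:
  assumes sol0: "primitive_solution a b \<alpha>0 \<beta>0 \<gamma>0"
    and sol1: "primitive_solution a b \<alpha>1 \<beta>1 \<gamma>1"
  defines "t \<equiv> a * \<alpha>0 * \<alpha>1 + b * \<beta>0 * \<beta>1 - 4 * \<gamma>0 * \<gamma>1"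
  assumes "t \<noteq> 0" "prime r" "odd (multiplicity r t)"
  shows "r dvd 2 * a * b"
proof (rule ccontr)
  assume nd: "\<not> r dvd 2 * a * b"
  then have nd': "\<not> r dvd 2" "\<not> r dvd a" "\<not> r dvd b"
    by (meson dvd_mult dvd_mult2)+
  have r4: "\<not> r dvd 4 * x" if "\<not> r dvd x" for x
  proof -
    have "4 * x = 2 * (2 * x)" by simp
    then show ?thesis using that nd'(1) \<open>prime r\<close> by (metis prime_dvd_mult_iff)
  qed
  have r8: "r dvd 8 * x \<Longrightarrow> r dvd x" for x
  proof -
    have "8 * x = 4 * (2 * x)" by simp
    then show "r dvd 8 * x \<Longrightarrow> r dvd x"
      using r4[of "2 * x"] nd'(1) \<open>prime r\<close> by (metis prime_dvd_mult_iff)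
  qed
  have eqs: "a * \<alpha>0\<^sup>2 + b * \<beta>0\<^sup>2 = 4 * \<gamma>0\<^sup>2" "a * \<alpha>1\<^sup>2 + b * \<beta>1\<^sup>2 = 4 * \<gamma>1\<^sup>2"
    using sol0 sol1 unfolding primitive_solution_def by auto
  note ids = polar_form_identities[OF eqs, folded t_def]
  have rt: "r dvd t"
    using assms(6) not_dvd_imp_multiplicity_0[of r t] by fastforce
  \<comment> \<open>Otherwise \<open>r\<close> would occur in \<open>t\<close> as often as in \<open>k * c\<^sup>2\<close>, an even number of times.\<close>
  have key: "r dvd s" if "t * s = k * c\<^sup>2" "\<not> r dvd k" for s k c
    using even_multiplicity_cofactor[OF \<open>prime r\<close> \<open>t \<noteq> 0\<close> _ that(2,1)] assms(6) by blast
  have "r dvd t - 2 * a * \<alpha>0 * \<alpha>1"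
    by (rule key[OF ids(1)]) (rule r4, rule nd')
  then have "r dvd 2 * a * \<alpha>0 * \<alpha>1"
    using rt by (meson dvd_diff_right_iff)
  then have A: "r dvd \<alpha>0 \<or> r dvd \<alpha>1"
    using nd' \<open>prime r\<close> by (simp add: prime_dvd_mult_iff)
  have "r dvd t - 2 * b * \<beta>0 * \<beta>1"
    by (rule key[OF ids(2)]) (rule r4, rule nd')
  then have "r dvd 2 * b * \<beta>0 * \<beta>1"
    using rt by (meson dvd_diff_right_iff)
  then have B: "r dvd \<beta>0 \<or> r dvd \<beta>1"
    using nd' \<open>prime r\<close> by (simp add: prime_dvd_mult_iff)
  have "r dvd t + 8 * \<gamma>0 * \<gamma>1"
    by (rule key[OF ids(3)]) (use nd' \<open>prime r\<close> in \<open>simp add: prime_dvd_mult_iff\<close>)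
  then have "r dvd 8 * (\<gamma>0 * \<gamma>1)"
    using rt by (metis dvd_add_right_iff mult.assoc)
  then have C: "r dvd \<gamma>0 \<or> r dvd \<gamma>1"
    using r8 \<open>prime r\<close> prime_dvd_mult_iff by blast
  show False
    using A B C primitive_solution_pairwise_coprime[OF sol0 \<open>prime r\<close> nd]
      primitive_solution_pairwise_coprime[OF sol1 \<open>prime r\<close> nd] by blast
qed

text \<open>Here it matters that \<open>l\<close> divides the second coefficient only once: if \<open>l\<close> divided $\gamma$, it
  would divide $\alpha$, and comparing powers of \<open>l\<close> in the equation it would divide $\beta$.\<close>

lemma gamma_not_dvd:
  assumes sol: "primitive_solution a (l * b) \<alpha> \<beta> \<gamma>" and l: "prime l" "\<not> l dvd a * b"
  shows "\<not> l dvd \<gamma>"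
proof
  assume g: "l dvd \<gamma>"
  have eq: "a * \<alpha>\<^sup>2 + l * b * \<beta>\<^sup>2 = 4 * \<gamma>\<^sup>2"
    using sol unfolding primitive_solution_def by simp
  have nd: "\<not> l dvd a" "\<not> l dvd b"
    using l by auto
  have "a * \<alpha>\<^sup>2 = 4 * \<gamma>\<^sup>2 - l * (b * \<beta>\<^sup>2)" using eq by simp
  moreover have "l dvd 4 * \<gamma>\<^sup>2 - l * (b * \<beta>\<^sup>2)"
    using g by (simp add: power2_eq_square)
  ultimately have al: "l dvd \<alpha>"
    using nd l(1) by (metis prime_dvd_mult_iff prime_dvd_power)
  obtain x z where x: "\<alpha> = l * x" and z: "\<gamma> = l * z" using al g by blast
  have "l * (b * \<beta>\<^sup>2) = l * (l * (4 * z\<^sup>2 - a * x\<^sup>2))"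
    using eq unfolding x z by (simp add: algebra_simps power2_eq_square)
  then have "b * \<beta>\<^sup>2 = l * (4 * z\<^sup>2 - a * x\<^sup>2)"
    using l(1) by (metis mult_left_cancel not_prime_0)
  then have "l dvd \<beta>"
    using nd l(1) by (metis dvd_triv_left prime_dvd_mult_iff prime_dvd_power)
  then show False
    using primitive_solution_no_common_prime[OF sol l(1)] al g by blast
qed

text \<open>Write \<open>s\<close> for $t + 8\gamma_0\gamma_1$, so that $ts = -ablc^2$. If \<open>l\<close> does not divide \<open>t\<close>, it
  divides \<open>s\<close>, and $8\gamma_0\gamma_1 \equiv -t$ with \<open>t\<close> a square modulo \<open>l\<close>. If \<open>l\<close> divides \<open>t\<close>, then
  \<open>s\<close> is congruent to the unit $8\gamma_0\gamma_1$; dividing out the powers of \<open>l\<close> from \<open>t\<close> and \<open>c\<close> leaves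
  $ds = -abe^2$ with \<open>d\<close> and \<open>ab\<close> squares modulo \<open>l\<close>.\<close>

lemma QuadRes_gamma_product:
  assumes sol0: "primitive_solution a (l * b) \<alpha>0 \<beta>0 \<gamma>0"
    and sol1: "primitive_solution a (l * b) \<alpha>1 \<beta>1 \<gamma>1"
    and l: "prime l" "\<not> l dvd 2 * a * b"
    and minus1: "QuadRes l (- 1)"
    and bad: "\<And>r. prime r \<Longrightarrow> r dvd 2 * a * b \<Longrightarrow> QuadRes l r"
  shows "QuadRes l (\<gamma>0 * \<gamma>1)"
proof -
  define t where "t = a * \<alpha>0 * \<alpha>1 + l * b * \<beta>0 * \<beta>1 - 4 * \<gamma>0 * \<gamma>1"
  define s where "s = t + 8 * \<gamma>0 * \<gamma>1"
  define c where "c = \<alpha>0 * \<beta>1 - \<alpha>1 * \<beta>0"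
  have eqs: "a * \<alpha>0\<^sup>2 + l * b * \<beta>0\<^sup>2 = 4 * \<gamma>0\<^sup>2" "a * \<alpha>1\<^sup>2 + l * b * \<beta>1\<^sup>2 = 4 * \<gamma>1\<^sup>2"
    using sol0 sol1 unfolding primitive_solution_def by auto
  note ids = polar_form_identities[OF eqs, folded t_def]
  have nd: "\<not> l dvd 2" "\<not> l dvd a" "\<not> l dvd b"
    using l(2) by (meson dvd_mult dvd_mult2)+
  have ndab: "\<not> l dvd a * b" using nd l(1) by (simp add: prime_dvd_mult_iff)
  have "a \<noteq> 0" "b \<noteq> 0" "l \<noteq> 0" using nd l(1) by auto
  have g: "\<not> l dvd \<gamma>0" "\<not> l dvd \<gamma>1"
    using gamma_not_dvd[OF sol0 l(1) ndab] gamma_not_dvd[OF sol1 l(1) ndab]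
    by auto
  have not_unit: "\<not> is_unit l" using l(1) not_prime_unit by blast
  have two: "QuadRes l 2" by (rule bad) auto
  have "QuadRes l (2 * 2\<^sup>2)" by (rule QuadRes_mult[OF two QuadRes_square])
  then have eight: "QuadRes l 8" by simp
  have "(8::int) = 2 ^ 3" by simp
  then have nd8: "\<not> l dvd 8"
    using nd(1) l(1) by (metis prime_dvd_power)
  have ts: "t * s = - a * (l * b) * c\<^sup>2"
    using ids(3) unfolding s_def c_def .
  show ?thesis
  proof (cases "t = 0")
    case True
    have "\<gamma>0 = \<gamma>1"
    proof (rule primitive_solution_gamma_eq[OF sol0 sol1])
      show "\<gamma>0 * \<alpha>1 = \<gamma>1 * \<alpha>0" using ids(2) True \<open>a \<noteq> 0\<close> by simp
      show "\<gamma>0 * \<beta>1 = \<gamma>1 * \<beta>0" using ids(1) True \<open>b \<noteq> 0\<close> \<open>l \<noteq> 0\<close> by simp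
    qed
    then show ?thesis using QuadRes_square[of l \<gamma>0] by (simp add: power2_eq_square)
  next
    case False
    have odd_mult: "QuadRes l r" if "prime r" "odd (multiplicity r t)" "r \<noteq> l" for r
    proof -
      have "r dvd 2 * a * (l * b)"
        using polar_form_odd_multiplicity[OF sol0 sol1] False that(1,2) unfolding t_def by blast
      moreover have "\<not> r dvd l" using that(1,3) l(1) primes_dvd_imp_eq by blast
      ultimately have "r dvd 2 * a * b"
        using that(1) by (simp add: prime_dvd_mult_iff)
      then show ?thesis using bad that(1) by blast
    qed
    \<comment> \<open>A residue \<open>d\<close> that can be cancelled: \<open>1\<close> in the first case, the prime-to-\<open>l\<close> part of \<open>t\<close> in
        the second.\<close>
    have "\<exists>d. \<not> l dvd d \<and> QuadRes l d \<and> QuadRes l (d * (8 * (\<gamma>0 * \<gamma>1)))"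
    proof (cases "l dvd t")
      case ldt: False
      have tq: "QuadRes l t"
      proof (rule QuadRes_of_odd_multiplicity[OF False minus1])
        fix r assume r: "prime r" "odd (multiplicity r t)"
        then have "r \<noteq> l" using not_dvd_imp_multiplicity_0[OF ldt] by auto
        then show "QuadRes l r" using odd_mult r by blast
      qed
      have "l dvd t * s" unfolding ts by simp
      then have "l dvd s" using ldt l(1) by (simp add: prime_dvd_mult_iff)
      then have "[8 * (\<gamma>0 * \<gamma>1) = - 1 * t] (mod l)"
        unfolding s_def by (simp add: cong_iff_dvd_diff algebra_simps)
      moreover have "QuadRes l (- 1 * t)" by (rule QuadRes_mult[OF minus1 tq])
      ultimately have "QuadRes l (8 * (\<gamma>0 * \<gamma>1))" by (simp add: QuadRes_cong)
      then show ?thesis using QuadRes_square[of l 1] l(1) by (intro exI[of _ 1]) auto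
    next
      case ldt: True
      obtain d where d: "t = l ^ multiplicity l t * d" "\<not> l dvd d"
        using multiplicity_decompose'[OF False not_unit] by blast
      define k where "k = multiplicity l t"
      have td: "t = l ^ k * d" unfolding k_def by (rule d(1))
      have "d \<noteq> 0" using d(2) by auto
      have dq: "QuadRes l d"
      proof (rule QuadRes_of_odd_multiplicity[OF \<open>d \<noteq> 0\<close> minus1])
        fix r assume r: "prime r" "odd (multiplicity r d)"
        then have "r \<noteq> l" using d(2) not_dvd_imp_multiplicity_0[of l d] by auto
        then have "\<not> r dvd l ^ k" using r(1) l(1) by (metis prime_dvd_power primes_dvd_imp_eq)
        then have "multiplicity r t = multiplicity r d"
          using prime_imp_prime_elem[OF r(1)] \<open>d \<noteq> 0\<close> \<open>l \<noteq> 0\<close> td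
          by (simp add: prime_elem_multiplicity_mult_distrib not_dvd_imp_multiplicity_0)
        then show "QuadRes l r" using odd_mult r \<open>r \<noteq> l\<close> by simp
      qed
      have nds: "\<not> l dvd s"
      proof
        assume "l dvd s"
        then have "l dvd 8 * (\<gamma>0 * \<gamma>1)"
          using ldt unfolding s_def by (simp add: dvd_add_right_iff mult.assoc)
        then show False using nd8 g l(1) by (simp add: prime_dvd_mult_iff)
      qed
      have "c \<noteq> 0" using ts False nds by auto
      obtain e where e: "c = l ^ multiplicity l c * e" "\<not> l dvd e"
        using multiplicity_decompose'[OF \<open>c \<noteq> 0\<close> not_unit] by blast
      define j where "j = multiplicity l c"
      have main: "l ^ k * (d * s) = l ^ (2 * j + 1) * (- 1 * (a * b) * e\<^sup>2)"
      proof -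
        have "c = l ^ j * e"
          unfolding j_def by (rule e(1))
        with td have "l ^ k * (d * s) = - a * (l * b) * (l ^ j * e)\<^sup>2"
          using ts by (simp add: mult.assoc)
        then show ?thesis
          by (simp add: power_mult_distrib power_mult power2_eq_square mult_ac)
      qed
      \<comment> \<open>The power of \<open>l\<close> in \<open>t\<close> is odd, because \<open>l\<close> occurs once in the coefficients.\<close>
      have "k = multiplicity l (l ^ k * (d * s))"
        using d(2) nds l(1) \<open>l \<noteq> 0\<close>
        by (intro multiplicity_eqI[symmetric]) (auto simp: prime_dvd_mult_iff)
      also have "\<dots> = 2 * j + 1"
        unfolding main using ndab e(2) l(1) \<open>l \<noteq> 0\<close>
        by (intro multiplicity_eqI) (auto simp: prime_dvd_mult_iff prime_dvd_power_iff)
      finally have "k = 2 * j + 1" .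
      then have "d * s = - 1 * (a * b) * e\<^sup>2"
        using main mult_left_cancel[of "l ^ (2 * j + 1)"] \<open>l \<noteq> 0\<close>
        by (metis power_not_zero)
      moreover have "QuadRes l (a * b)"
      proof (rule QuadRes_of_odd_multiplicity[OF _ minus1])
        show "a * b \<noteq> 0" using \<open>a \<noteq> 0\<close> \<open>b \<noteq> 0\<close> by simp
        fix r assume r: "prime r" "odd (multiplicity r (a * b))"
        then have "r dvd a * b" using not_dvd_imp_multiplicity_0[of r "a * b"] by fastforce
        then show "QuadRes l r" using bad[OF r(1)] by (simp add: mult.assoc)
      qed
      ultimately have "QuadRes l (d * s)"
        by (simp only: QuadRes_mult QuadRes_square minus1)
      moreover have "[s = 8 * (\<gamma>0 * \<gamma>1)] (mod l)"
        using ldt unfolding s_def by (simp add: cong_iff_dvd_diff algebra_simps)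
      ultimately have "QuadRes l (d * (8 * (\<gamma>0 * \<gamma>1)))"
        using QuadRes_cong[OF cong_mult[OF cong_refl]] by blast
      then show ?thesis using d(2) dq by blast
    qed
    then have "QuadRes l (8 * (\<gamma>0 * \<gamma>1))"
      using QuadRes_cancel[OF l(1)] by blast
    then show ?thesis
      using QuadRes_cancel[OF l(1) nd8 eight] by blast
  qed
qed

lemma Legendre_gamma_eq:
  assumes sol0: "primitive_solution a (l * b) \<alpha>0 \<beta>0 \<gamma>0"
    and sol1: "primitive_solution a (l * b) \<alpha>1 \<beta>1 \<gamma>1"
    and l: "prime l" "\<not> l dvd 2 * a * b"
    and minus1: "QuadRes l (- 1)"
    and bad: "\<And>r. prime r \<Longrightarrow> r dvd 2 * a * b \<Longrightarrow> QuadRes l r"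
  shows "Legendre \<gamma>0 l = Legendre \<gamma>1 l"
proof -
  have prod: "QuadRes l (\<gamma>0 * \<gamma>1)" "QuadRes l (\<gamma>1 * \<gamma>0)"
    using QuadRes_gamma_product[OF sol0 sol1 l minus1 bad] by (simp_all add: mult.commute)
  have ndab: "\<not> l dvd a * b" using l(2) by (metis dvd_mult mult.assoc)
  note g = gamma_not_dvd[OF sol0 l(1) ndab] gamma_not_dvd[OF sol1 l(1) ndab]
  have "QuadRes l \<gamma>0 \<longleftrightarrow> QuadRes l \<gamma>1"
    using QuadRes_cancel[OF l(1) g(1) _ prod(1)] QuadRes_cancel[OF l(1) g(2) _ prod(2)] by blast
  then show ?thesis
    using g by (simp add: Legendre_def cong_0_iff)
qed

section \<open>Evaluation of the symbols\<close>

lemma add_symbol_prime: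
  assumes "prime l" "\<not> int l dvd A"
  shows "add_symbol A l = (if Legendre A (int l) = 1 then 0 else 1)"
proof -
  have J: "Jacobi A l = Legendre A (int l)"
    using assms(1) by (simp add: Jacobi_def prime_factorization_prime)
  have "Legendre A (int l) = 1 \<or> Legendre A (int l) = - 1"
    using assms(2) by (simp add: Legendre_def cong_0_iff)
  then show ?thesis
    unfolding add_symbol_def J neg_one_pow_def by (intro the_equality) (auto split: if_splits)
qed

lemma cong_one_minus_one_iff:
  assumes "2 < (l::int)"
  shows "\<not> [1 = - 1] (mod l)" "\<not> [- 1 = 1] (mod l)"
  using assms zdvd_imp_le[of l 2] by (auto simp: cong_iff_dvd_diff)

lemma add_symbol_euler:
  assumes "prime l" "2 < l" "[neg_one_pow b = A ^ ((l - 1) div 2)] (mod int l)"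
  shows "\<not> int l dvd A" "add_symbol A l = b"
proof -
  have E: "[Legendre A (int l) = neg_one_pow b] (mod int l)"
    using euler_criterion[OF assms(1,2)] assms(3) by (meson cong_sym cong_trans)
  have "\<not> int l dvd neg_one_pow b"
    using assms(2) zdvd_not_zless[of 1 "int l"] by (auto simp: neg_one_pow_def)
  then show nd: "\<not> int l dvd A"
    using cong_dvd_iff[OF E] by (auto simp: Legendre_def cong_0_iff)
  have "Legendre A (int l) = neg_one_pow b"
    using E cong_one_minus_one_iff[of "int l"] assms(2) nd
    by (auto simp: Legendre_def neg_one_pow_def cong_0_iff split: if_splits)
  then show "add_symbol A l = b"
    using add_symbol_prime[OF assms(1) nd] by (auto simp: neg_one_pow_def split: if_splits)
qed

lemma add_symbol_mult:
  assumes "prime l" "2 < l" "\<not> int l dvd A" "\<not> int l dvd B"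
  shows "add_symbol (A * B) l = add_symbol A l + add_symbol B l"
proof -
  have pow: "[neg_one_pow (add_symbol x l) = x ^ ((l - 1) div 2)] (mod int l)"
    if "\<not> int l dvd x" for x
  proof -
    have "neg_one_pow (add_symbol x l) = Legendre x (int l)"
      using add_symbol_prime[OF assms(1) that] that
      by (auto simp: neg_one_pow_def Legendre_def cong_0_iff)
    then show ?thesis using euler_criterion[OF assms(1,2)] by metis
  qed
  have "neg_one_pow (x + y) = neg_one_pow x * neg_one_pow y" for x y
    by (cases x; cases y) (simp_all add: neg_one_pow_def)
  then show ?thesis
    using cong_mult[OF pow pow] assms
    by (intro add_symbol_euler(2)) (auto simp: power_mult_distrib)
qed

lemma add_symbol4_eq:
  assumes "2 < l" "[neg_one_pow b = a ^ ((l - 1) div 4)] (mod int l)"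
  shows "add_symbol4 a l = b"
  unfolding add_symbol4_def
proof (rule the_equality)
  fix b' assume "[neg_one_pow b' = a ^ ((l - 1) div 4)] (mod int l)"
  then have "[neg_one_pow b' = neg_one_pow b] (mod int l)"
    using assms(2) by (meson cong_sym cong_trans)
  then show "b' = b"
    using cong_one_minus_one_iff[of "int l"] assms(1)
    by (cases b; cases b') (auto simp: neg_one_pow_def)
qed (rule assms(2))

text \<open>The two square roots of \<open>2\<close> give the same symbol because $(r + 1)(-r + 1) \equiv -1$ is a
  square modulo \<open>l\<close>.\<close>

lemma c_symbol_eq:
  assumes "prime l" "2 < l" "QuadRes (int l) (- 1)" "[r\<^sup>2 = 2] (mod int l)"
  shows "c_symbol l = add_symbol (r + 1) l"
proof -
  define x where "x = (SOME r. [r\<^sup>2 = 2] (mod int l))"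
  have x: "[x\<^sup>2 = 2] (mod int l)"
    unfolding x_def using assms(4) by (rule someI)
  have l: "prime (int l)" using assms(1) by simp
  have nd: "\<not> int l dvd y + 1" "\<not> int l dvd - y + 1" if "[y\<^sup>2 = 2] (mod int l)" for y
  proof -
    have "[(y + 1) * (- y + 1) = - 1] (mod int l)"
      using cong_diff[OF cong_refl that, of 1] by (simp add: algebra_simps power2_eq_square)
    then have "\<not> int l dvd (y + 1) * (- y + 1)"
      using l assms(2) by (simp add: cong_dvd_iff)
    then show "\<not> int l dvd y + 1" "\<not> int l dvd - y + 1" by auto
  qed
  have "Legendre (x + 1) (int l) = Legendre (r + 1) (int l)"
  proof -
    have "[x\<^sup>2 = r\<^sup>2] (mod int l)" using x assms(4) by (meson cong_sym cong_trans)
    then have "int l dvd (x - r) * (x + r)"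
      by (simp add: cong_iff_dvd_diff algebra_simps power2_eq_square)
    then consider "int l dvd x - r" | "int l dvd x + r"
      using l prime_dvd_mult_iff by blast
    then show ?thesis
    proof cases
      case 1
      then have "[x + 1 = r + 1] (mod int l)" by (simp add: cong_iff_dvd_diff)
      then show ?thesis by (rule Legendre_cong)
    next
      case 2
      then have c: "[x + 1 = - r + 1] (mod int l)" by (simp add: cong_iff_dvd_diff)
      have "[(r + 1) * (- r + 1) = - 1] (mod int l)"
        using cong_diff[OF cong_refl assms(4), of 1] by (simp add: algebra_simps power2_eq_square)
      then have prod: "QuadRes (int l) ((r + 1) * (- r + 1))"
        using assms(3) QuadRes_cong by blast
      then have prod': "QuadRes (int l) ((- r + 1) * (r + 1))"
        by (simp only: mult.commute)
      have "QuadRes (int l) (r + 1) \<longleftrightarrow> QuadRes (int l) (- r + 1)"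
        using QuadRes_cancel[OF l nd(1)[OF assms(4)] _ prod]
          QuadRes_cancel[OF l nd(2)[OF assms(4)] _ prod'] by blast
      then show ?thesis
        unfolding Legendre_cong[OF c] using nd[OF assms(4)]
        by (simp add: Legendre_def cong_0_iff)
    qed
  qed
  then show ?thesis
    unfolding c_symbol_def x_def[symmetric]
    using add_symbol_prime[OF assms(1)] nd(1)[OF x] nd(1)[OF assms(4)] by simp
qed

section \<open>The invariants from explicit solutions\<close>

text \<open>Conditions modulo \<open>l\<close> that make $[\gamma/l]$ well defined for the conics with
  coefficients \<open>p\<close> and \<open>l\<close>, up to sign and powers of two. They hold whenever \<open>p\<close> and \<open>l\<close> are
  distinct primes, \<open>l\<close> is congruent to \<open>1\<close> modulo \<open>8\<close> and \<open>p\<close> is a square modulo \<open>l\<close>.\<close>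

definition residue_pair :: "nat \<Rightarrow> nat \<Rightarrow> bool" where
  "residue_pair p l \<longleftrightarrow> prime p \<and> prime l \<and> p \<noteq> l \<and> 2 < l \<and>
     QuadRes (int l) (- 1) \<and> QuadRes (int l) 2 \<and> QuadRes (int l) (int p)"

lemma solution_gamma_swap: "solution_gamma a b = solution_gamma b a"
proof -
  have "(\<exists>\<alpha> \<beta>. primitive_solution a b \<alpha> \<beta> \<gamma>) \<longleftrightarrow> (\<exists>\<alpha> \<beta>. primitive_solution b a \<alpha> \<beta> \<gamma>)" for \<gamma>
    using primitive_solution_swap by blast
  then show ?thesis unfolding solution_gamma_def by simp
qed

text \<open>The factors \<open>s\<close> and \<open>t\<close> cover all the conics in the two invariants: they contribute only the
  prime \<open>2\<close> and a sign, which are squares modulo \<open>l\<close>.\<close>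

lemma add_symbol_solution_gamma:
  assumes "residue_pair p l" "a = s * int p" "b = t * int l" "s dvd 4" "t dvd 4"
    and sol: "primitive_solution a b \<alpha> \<beta> \<gamma>"
  shows "add_symbol (solution_gamma a b) l = add_symbol \<gamma> l"
    and "\<not> int l dvd solution_gamma a b"
proof -
  have pl: "prime p" "prime l" "p \<noteq> l" "2 < l"
    and minus1: "QuadRes (int l) (- 1)" and qr: "QuadRes (int l) 2" "QuadRes (int l) (int p)"
    using assms(1) unfolding residue_pair_def by auto
  have b: "b = int l * t" using assms(3) by simp
  have "\<exists>\<alpha> \<beta>. primitive_solution a b \<alpha> \<beta> (solution_gamma a b)"
    unfolding solution_gamma_def by (rule someI_ex) (use sol in blast)
  then obtain \<alpha>' \<beta>' where sol': "primitive_solution a b \<alpha>' \<beta>' (solution_gamma a b)"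
    by blast
  have l: "prime (int l)" using pl(2) by simp
  have dvd4: "r dvd 2" if "prime r" "r dvd x" "x dvd 4" for r x :: int
  proof -
    have "r dvd 2 ^ 2" using dvd_trans[OF that(2,3)] by simp
    then show ?thesis using that(1) prime_dvd_power by blast
  qed
  have bad: "r = 2 \<or> r = int p" if r: "prime r" "r dvd 2 * a * t" for r
  proof -
    have "r dvd 2 \<or> r dvd int p"
      using r dvd4[OF r(1) _ assms(4)] dvd4[OF r(1) _ assms(5)] unfolding assms(2)
      by (auto simp: prime_dvd_mult_iff)
    then show ?thesis
      using r(1) pl(1) primes_dvd_imp_eq[of r 2] primes_dvd_imp_eq[of r "int p"] by auto
  qed
  have nd: "\<not> int l dvd 2 * a * t"
    using bad[OF l] pl by auto
  then have nd': "\<not> int l dvd a * t" by (metis dvd_mult mult.assoc)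
  have g: "\<not> int l dvd solution_gamma a b" "\<not> int l dvd \<gamma>"
    using gamma_not_dvd[OF sol[unfolded b] l nd']
      gamma_not_dvd[OF sol'[unfolded b] l nd'] unfolding b by auto
  have "Legendre (solution_gamma a b) (int l) = Legendre \<gamma> (int l)"
    by (rule Legendre_gamma_eq[OF sol'[unfolded b] sol[unfolded b] l nd minus1, folded b])
      (use bad qr in blast)
  then show "add_symbol (solution_gamma a b) l = add_symbol \<gamma> l"
    using add_symbol_prime[OF pl(2)] g by simp
  show "\<not> int l dvd solution_gamma a b" by (rule g(1))
qed

text \<open>Symbols modulo \<open>p\<close> are obtained from those modulo \<open>q\<close> by exchanging the two terms on the left
  of the equation, which changes neither the conic nor the last coordinate of its solutions.\<close>

lemma Pi_inv_eq:
  assumes "residue_pair p q" "residue_pair q p"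
    and "primitive_solution (int p) (int q) \<alpha> \<beta> \<gamma>"
    and "primitive_solution (int p) (- int q) \<alpha>' \<beta>' \<gamma>'"
    and "primitive_solution (int p) (- (2 * int q)) \<alpha>'' \<beta>'' \<gamma>''"
  shows "Pi_inv p q = c_symbol p * c_symbol q + c_symbol p * add_symbol \<gamma> q
    + c_symbol q * add_symbol \<gamma> p
    + (add_symbol \<gamma>' q + add_symbol \<gamma>'' q) * (add_symbol \<gamma> q + add_symbol \<gamma> p)"
proof -
  have q: "prime q" "2 < q" using assms(1) unfolding residue_pair_def by auto
  note g = add_symbol_solution_gamma[OF assms(1) _ _ _ _ assms(3), of 1 1]
  note g' = add_symbol_solution_gamma[OF assms(1) _ _ _ _ assms(4), of 1 "- 1"]
  note g'' = add_symbol_solution_gamma[OF assms(1) _ _ _ _ assms(5), of 1 "- 2"]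
  note gp = add_symbol_solution_gamma[OF assms(2) _ _ _ _ primitive_solution_swap[THEN iffD1, OF assms(3)],
      of 1 1, unfolded solution_gamma_swap[of "int q"]]
  show ?thesis
    unfolding Pi_inv_def Let_def
    using g(1) gp(1) g'(1) g''(1) add_symbol_mult[OF q g'(2) g''(2)] by simp
qed

lemma Pi2_inv_eq:
  assumes "residue_pair p q" "residue_pair q p"
    and "primitive_solution (int p) (2 * int q) \<alpha>\<^sub>p \<beta>\<^sub>p \<gamma>\<^sub>p"
    and "primitive_solution (int p) (- (2 * int q)) \<alpha>\<^sub>p' \<beta>\<^sub>p' \<gamma>\<^sub>p'"
    and "primitive_solution (int q) (- (2 * int p)) \<alpha>\<^sub>q' \<beta>\<^sub>q' \<gamma>\<^sub>q'"
    and "primitive_solution (int p) (- (4 * int q)) \<alpha>\<^sub>p'' \<beta>\<^sub>p'' \<gamma>\<^sub>p''"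
  shows "Pi2_inv p q =
    (add_symbol \<gamma>\<^sub>p' q + add_symbol \<gamma>\<^sub>p'' q) * (add_symbol \<gamma>\<^sub>p q + add_symbol \<gamma>\<^sub>p' q)
    + (c_symbol p + add_symbol \<gamma>\<^sub>p' p) * (c_symbol q + add_symbol \<gamma>\<^sub>q' q)
    + add_symbol \<gamma>\<^sub>p q * add_symbol \<gamma>\<^sub>p' q"
proof -
  have q: "prime q" "2 < q" using assms(1) unfolding residue_pair_def by auto
  note g = add_symbol_solution_gamma[OF assms(1) _ _ _ _ assms(3), of 1 2]
  note g' = add_symbol_solution_gamma[OF assms(1) _ _ _ _ assms(4), of 1 "- 2"]
  note g'' = add_symbol_solution_gamma[OF assms(1) _ _ _ _ assms(6), of 1 "- 4"]
  note gp = add_symbol_solution_gamma[OF assms(2) _ _ _ _ primitive_solution_swap[THEN iffD1, OF assms(4)],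
      of "- 2" 1, unfolded solution_gamma_swap[of "- (2 * int q)"]]
  note gq = add_symbol_solution_gamma[OF assms(1) _ _ _ _ primitive_solution_swap[THEN iffD1, OF assms(5)],
      of "- 2" 1, unfolded solution_gamma_swap[of "- (2 * int p)"]]
  show ?thesis
    unfolding Pi2_inv_def Let_def
    using g(1) gp(1) gq(1) g'(1) g''(1) add_symbol_mult[OF q g'(2) g''(2)] by simp
qed

section \<open>Two pairs of primes with the same symbols\<close>

lemma primes: "prime (17::nat)" "prime (73::nat)" "prime (89::nat)" "prime (97::nat)"
  by simp_all

lemma residue_pairI:
  assumes "prime p" "prime l" "p \<noteq> l" "2 < l" "[x\<^sup>2 = - 1] (mod int l)" "[y\<^sup>2 = 2] (mod int l)"
    "[z\<^sup>2 = int p] (mod int l)"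
  shows "residue_pair p l"
  using assms unfolding residue_pair_def QuadRes_def by blast

lemma residue_pairs:
  "residue_pair 17 89" "residue_pair 89 17" "residue_pair 97 73" "residue_pair 73 97"
proof -
  show "residue_pair 17 89"
    by (rule residue_pairI[OF primes(1,3), of 34 25 27]) (simp_all add: cong_def)
  show "residue_pair 89 17"
    by (rule residue_pairI[OF primes(3,1), of 4 6 2]) (simp_all add: cong_def)
  show "residue_pair 97 73"
    by (rule residue_pairI[OF primes(4,2), of 27 32 30]) (simp_all add: cong_def)
  show "residue_pair 73 97"
    by (rule residue_pairI[OF primes(2,4), of 22 14 48]) (simp_all add: cong_def)
qed

lemma admissible_pairI:
  assumes "residue_pair q p" "[p = 1] (mod 8)" "[q = 1] (mod 8)"
  shows "admissible_pair p q"
proof -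
  have pq: "prime p" "prime q" "p \<noteq> q" "QuadRes (int p) (int q)"
    using assms(1) unfolding residue_pair_def by auto
  then have "\<not> p dvd q" using primes_dvd_imp_eq by blast
  then have "Jacobi (int q) p = 1"
    using pq by (simp add: Jacobi_def prime_factorization_prime Legendre_def cong_0_iff)
  then show ?thesis
    using pq assms(2,3) unfolding admissible_pair_def by simp
qed

lemma admissible_17_89: "admissible_pair 17 89" and admissible_97_73: "admissible_pair 97 73"
  using admissible_pairI residue_pairs(2,4) by (simp_all add: cong_def)

lemma add_symbol_values_17:
  "add_symbol 7 17 = 1"
  "add_symbol 11 17 = 1"
  "add_symbol 19 17 = 0"
  by (rule add_symbol_euler(2)[OF primes(1)]; simp add: neg_one_pow_def cong_def)+

lemma add_symbol_values_73:
  "add_symbol 17 73 = 1"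
  "add_symbol 32 73 = 0"
  "add_symbol 33 73 = 1"
  "add_symbol 47 73 = 1"
  "add_symbol 53 73 = 1"
  "add_symbol 64 73 = 0"
  "add_symbol 69 73 = 0"
  by (rule add_symbol_euler(2)[OF primes(2)]; simp add: neg_one_pow_def cong_def)+

lemma add_symbol_values_89:
  "add_symbol 4 89 = 0"
  "add_symbol 8 89 = 0"
  "add_symbol 11 89 = 0"
  "add_symbol 19 89 = 1"
  "add_symbol 26 89 = 1"
  "add_symbol 27 89 = 1"
  "add_symbol 41 89 = 1"
  by (rule add_symbol_euler(2)[OF primes(3)]; simp add: neg_one_pow_def cong_def)+

lemma add_symbol_values_97:
  "add_symbol 15 97 = 1"
  "add_symbol 17 97 = 1"
  "add_symbol 47 97 = 0"
  by (rule add_symbol_euler(2)[OF primes(4)]; simp add: neg_one_pow_def cong_def)+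

lemmas add_symbol_values =
  add_symbol_values_17 add_symbol_values_73 add_symbol_values_89 add_symbol_values_97

lemma add_symbol4_values:
  "add_symbol4 17 89 = 1"
  "add_symbol4 73 97 = 0"
  "add_symbol4 89 17 = 0"
  "add_symbol4 97 73 = 1"
  by (rule add_symbol4_eq; simp add: neg_one_pow_def cong_def)+

lemma c_symbol_values:
  "c_symbol 17 = 1" "c_symbol 73 = 1" "c_symbol 89 = 1" "c_symbol 97 = 1"
  using residue_pairs c_symbol_eq[of 17 6] c_symbol_eq[of 73 32]
    c_symbol_eq[of 89 25] c_symbol_eq[of 97 14]
  by (simp_all add: residue_pair_def cong_def add_symbol_values)

lemma Pi_inv_17_89: "Pi_inv 17 89 = 0"
proof -
  have solutions:
    "primitive_solution (int 17) (int 89) 8 2 19"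
    "primitive_solution (int 17) (- int 89) 3 1 4"
    "primitive_solution (int 17) (- (2 * int 89)) 14 4 11"
    unfolding primitive_solution_def by (simp_all add: gcd_non_0_int)
  show ?thesis
    unfolding Pi_inv_eq[OF residue_pairs(1,2) solutions]
    by (simp add: add_symbol_values c_symbol_values)
qed

lemma Pi2_inv_17_89: "Pi2_inv 17 89 = 0"
proof -
  have solutions:
    "primitive_solution (int 17) (2 * int 89) 2 4 27"
    "primitive_solution (int 17) (- (2 * int 89)) 14 4 11"
    "primitive_solution (int 89) (- (2 * int 17)) 10 8 41"
    "primitive_solution (int 17) (- (4 * int 89)) 6 1 8"
    unfolding primitive_solution_def by (simp_all add: gcd_non_0_int)
  show ?thesis
    unfolding Pi2_inv_eq[OF residue_pairs(1,2) solutions]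
    by (simp add: add_symbol_values c_symbol_values)
qed

lemma Pi_inv_97_73: "Pi_inv 97 73 = 1"
proof -
  have solutions:
    "primitive_solution (int 97) (int 73) 8 6 47"
    "primitive_solution (int 97) (- int 73) 7 3 32"
    "primitive_solution (int 97) (- (2 * int 73)) 6 4 17"
    unfolding primitive_solution_def by (simp_all add: gcd_non_0_int)
  show ?thesis
    unfolding Pi_inv_eq[OF residue_pairs(3,4) solutions]
    by (simp add: add_symbol_values c_symbol_values)
qed

lemma Pi2_inv_97_73: "Pi2_inv 97 73 = 1"
proof -
  have solutions:
    "primitive_solution (int 97) (2 * int 73) 10 8 69"
    "primitive_solution (int 97) (- (2 * int 73)) 6 4 17"
    "primitive_solution (int 73) (- (2 * int 97)) 18 8 53"
    "primitive_solution (int 97) (- (4 * int 73)) 14 3 64"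
    unfolding primitive_solution_def by (simp_all add: gcd_non_0_int)
  show ?thesis
    unfolding Pi2_inv_eq[OF residue_pairs(3,4) solutions]
    by (simp add: add_symbol_values c_symbol_values)
qed

theorem proposition4p11:
  shows "(\<nexists>F :: bit \<times> bit \<times> bit \<times> bit \<Rightarrow> bit.
            \<forall>p q. admissible_pair p q \<longrightarrow>
              Pi_inv p q = F (c_symbol p, c_symbol q, add_symbol4 (int p) q, add_symbol4 (int q) p))
       \<and> (\<nexists>F :: bit \<times> bit \<times> bit \<times> bit \<Rightarrow> bit.
            \<forall>p q. admissible_pair p q \<longrightarrow>
              Pi2_inv p q = F (c_symbol p, c_symbol q, add_symbol4 (int p) q, add_symbol4 (int q) p))"
proof (intro conjI notI; elim exE)
  note symbol_values = c_symbol_values add_symbol4_values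
  show False if F: "\<forall>p q. admissible_pair p q \<longrightarrow>
      Pi_inv p q = F (c_symbol p, c_symbol q, add_symbol4 (int p) q, add_symbol4 (int q) p)"
    for F :: "bit \<times> bit \<times> bit \<times> bit \<Rightarrow> bit"
  proof -
    have "F (1, 1, 1, 0) = 0" "F (1, 1, 1, 0) = 1"
      using F[rule_format, OF admissible_17_89] F[rule_format, OF admissible_97_73]
      by (simp_all add: symbol_values Pi_inv_17_89 Pi_inv_97_73)
    then show False by simp
  qed
  show False if F: "\<forall>p q. admissible_pair p q \<longrightarrow>
      Pi2_inv p q = F (c_symbol p, c_symbol q, add_symbol4 (int p) q, add_symbol4 (int q) p)"
    for F :: "bit \<times> bit \<times> bit \<times> bit \<Rightarrow> bit"
  proof -
    have "F (1, 1, 1, 0) = 0" "F (1, 1, 1, 0) = 1"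
      using F[rule_format, OF admissible_17_89] F[rule_format, OF admissible_97_73]
      by (simp_all add: symbol_values Pi2_inv_17_89 Pi2_inv_97_73)
    then show False by simp
  qed
qed

end
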